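(* Let $\mathcal F_6$ be the set of eight 4-qubit product vectors in $\mathcal H_A\otimes\mathcal H_B\otimes\mathcal H_C\otimes\mathcal H_D=(\mathbb C^2)^{\otimes4}$ given by the rows of $$F_6=\begin{bmatrix} 0&0&0&0 \\ 0&1&h_2&i_2 \\ 1&g_3&0&i_3 \\ 1&g_3'&h_2&i_4 \\ f_5&1&h_2'&i_3' \\ f_5&0&1&i_4' \\ f_5'&g_3&1&i_2' \\ f_5'&g_3'&h_2'&1 \end{bmatrix},$$ where $f_5,g_3,h_2\neq0,1$; $i_2\neq0,i_3',i_4$; $i_3\neq0,i_4$; $i_4\neq0,1$; and, if $i_2=i_3$, then $i_2\neq1,i_4'$. Then $\mathcal F_6$ is a bipartite UPB in $\mathbb C^4\otimes\mathbb C^4$ across each of the three partitions of systems $AB:CD$, $AC:BD$ and $AD:BC$.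
   Context: Entries of the matrix are symbols for unit vectors of $\mathbb C^2$ (up to phase); a row $(a,b,c,d)$ represents the product vector $|a\rangle\otimes|b\rangle\otimes|c\rangle\otimes|d\rangle$, with columns $1,2,3,4$ corresponding to qubits $A,B,C,D$. The symbols $0,1$ stand for the computational basis $|0\rangle,|1\rangle$; $x'$ denotes the unit vector of $\mathbb C^2$ orthogonal to $x$ (unique up to phase). Equalities and inequalities of symbols are meant up to phase. A set of orthonormal bipartite product vectors in $\mathcal H_1\otimes\mathcal H_2$ is a (bipartite) UPB if no bipartite product vector is orthogonal to all of its elements. Being a bipartite UPB across, e.g., $AC:BD$ means being one in $\mathcal H_{AC}\otimes\mathcal H_{BD}$, where $\mathcal H_{AC}=\mathcal H_A\otimes\mathcal H_C$ and $\mathcal H_{BD}=\mathcal H_B\otimes\mathcal H_D$. *)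

theory Defs
  imports "HOL-Analysis.Analysis"
begin

text \<open>
  A finite-dimensional complex Hilbert space with an orthonormal basis indexed by \<open>'n\<close> is
  \<open>complex ^ 'n\<close>; the library norm on this type is the norm of the Hermitian inner product below.
  (The library inner product on this type is only its real part.)
  The tensor product of the spaces indexed by \<open>'m\<close> and \<open>'n\<close> is the space indexed by
  \<open>'m \<times> 'n\<close>. The qubit basis is indexed by the two elements 0 and 1 of the type \<open>2\<close>.
\<close>

type_synonym qubit = "complex ^ 2"
type_synonym four_qubits = "complex ^ (2 \<times> 2 \<times> 2 \<times> 2)"
type_synonym two_ququarts = "complex ^ ((2 \<times> 2) \<times> (2 \<times> 2))"

definition herm :: "complex ^ 'n::finite \<Rightarrow> complex ^ 'n \<Rightarrow> complex" where
  "herm x y = (\<Sum>i\<in>UNIV. cnj (x $ i) * y $ i)"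

definition tensor :: "complex ^ 'm::finite \<Rightarrow> complex ^ 'n::finite \<Rightarrow> complex ^ ('m \<times> 'n)" where
  "tensor u v = (\<chi> p. u $ fst p * v $ snd p)"

definition ket0 :: qubit where "ket0 = axis 0 1"
definition ket1 :: qubit where "ket1 = axis 1 1"

definition same_state :: "complex ^ 'n::finite \<Rightarrow> complex ^ 'n \<Rightarrow> bool"  (infix \<open>\<simeq>\<close> 50) where
  "x \<simeq> y \<longleftrightarrow> (\<exists>c. norm c = 1 \<and> x = c *s y)"

abbreviation different_state :: "complex ^ 'n::finite \<Rightarrow> complex ^ 'n \<Rightarrow> bool"  (infix \<open>\<nsimeq>\<close> 50) where
  "x \<nsimeq> y \<equiv> \<not> x \<simeq> y"

text \<open>\<open>orth_mate x x'\<close>: the unit vector \<open>x'\<close> represents the state orthogonal to the unit vector \<open>x\<close>.\<close>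

definition orth_mate :: "qubit \<Rightarrow> qubit \<Rightarrow> bool" where
  "orth_mate x x' \<longleftrightarrow> norm x = 1 \<and> norm x' = 1 \<and> herm x x' = 0"

definition product_vector :: "complex ^ ('m::finite \<times> 'n::finite) \<Rightarrow> bool" where
  "product_vector \<psi> \<longleftrightarrow> (\<exists>u v. u \<noteq> 0 \<and> v \<noteq> 0 \<and> \<psi> = tensor u v)"

definition bipartite_UPB :: "(complex ^ ('m::finite \<times> 'n::finite)) set \<Rightarrow> bool" where
  "bipartite_UPB S \<longleftrightarrow>
     (\<forall>\<psi>\<in>S. product_vector \<psi>) \<and>
     (\<forall>\<psi>\<in>S. norm \<psi> = 1) \<and>
     (\<forall>\<psi>\<in>S. \<forall>\<phi>\<in>S. \<psi> \<noteq> \<phi> \<longrightarrow> herm \<psi> \<phi> = 0) \<and>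
     \<not> (\<exists>\<phi>. product_vector \<phi> \<and> (\<forall>\<psi>\<in>S. herm \<psi> \<phi> = 0))"

text \<open>
  The canonical identifications of the four-qubit space with the tensor products
  of two two-qubit spaces, one for each partition of the four systems into pairs.
\<close>

definition across_AB_CD :: "four_qubits \<Rightarrow> two_ququarts" where
  "across_AB_CD \<psi> = vec_lambda (\<lambda>((a, b), (c, d)). \<psi> $ (a, b, c, d))"

definition across_AC_BD :: "four_qubits \<Rightarrow> two_ququarts" where
  "across_AC_BD \<psi> = vec_lambda (\<lambda>((a, c), (b, d)). \<psi> $ (a, b, c, d))"

definition across_AD_BC :: "four_qubits \<Rightarrow> two_ququarts" where
  "across_AD_BC \<psi> = vec_lambda (\<lambda>((a, d), (b, c)). \<psi> $ (a, b, c, d))"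

fun row_vector :: "qubit \<times> qubit \<times> qubit \<times> qubit \<Rightarrow> four_qubits" where
  "row_vector (a, b, c, d) = tensor a (tensor b (tensor c d))"

definition F6 ::
  "qubit \<Rightarrow> qubit \<Rightarrow> qubit \<Rightarrow> qubit \<Rightarrow> qubit \<Rightarrow> qubit \<Rightarrow>
   qubit \<Rightarrow> qubit \<Rightarrow> qubit \<Rightarrow> qubit \<Rightarrow> qubit \<Rightarrow> qubit \<Rightarrow> four_qubits set" where
  "F6 f5 f5' g3 g3' h2 h2' i2 i2' i3 i3' i4 i4' = row_vector ` set
     [(ket0, ket0, ket0, ket0),
      (ket0, ket1, h2,   i2  ),
      (ket1, g3,   ket0, i3  ),
      (ket1, g3',  h2,   i4  ),
      (f5,   ket1, h2',  i3' ),
      (f5,   ket0, ket1, i4' ),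
      (f5',  g3,   ket1, i2' ),
      (f5',  g3',  h2',  ket1)]"

end

(* Index the rows 1, ..., 8 by the vertices 000, 001, 010, 011, 101, 100, 110, 111 of a cube. Then row
   xyz is a(x,y) b(y,z) c(z,x) d(x,y,z), where the first argument of a, b, c chooses one of two
   orthonormal bases of C^2 without common states and the second a vector of it, and d takes
   orthogonal values at antipodal vertices. This form is invariant under cyclic shifts of A, B, C,
   so it suffices to treat AB:CD. The conditions on the i's say that d differs at adjacent
   vertices and is not constant on the three neighbours of any vertex.

   Suppose u (x) v is orthogonal to all rows, and let P, Q be the sets of vertices at which the AB
   part is orthogonal to u and the CD part is orthogonal to v; together they cover the cube. The
   determinant of four product vectors of C^2 (x) C^2 is an explicit difference of two products
   of 2x2 determinants. If two of the vectors share a factor, then only one of the products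
   survives, and the determinant is nonzero as soon as the remaining factors are different. This
   limits P and Q severely. The only other quadruples needed are z = x + y + k in P; there the
   moduli of the two products are 1 and less than 1. The remaining constraints on P and Q are
   propositional and contradictory. *)

theory Submission
  imports Defs
begin

section \<open>Qubits\<close>

text \<open>The 2x2 determinant. It is bilinear, unlike \<open>herm\<close>, and for unit vectors it
  vanishes exactly when the states agree, so inequalities of states become nonzero factors of
  determinants.\<close>

definition wedge :: "qubit \<Rightarrow> qubit \<Rightarrow> complex" where
  "wedge x y = x $ 0 * y $ 1 - x $ 1 * y $ 0"

lemma UNIV_two: "(UNIV :: 2 set) = {0, 1}"
  using UNIV_2 by auto

lemma sum_two: "sum f (UNIV :: 2 set) = f 0 + f 1"
  by (simp add: UNIV_two)

lemma qubit_eqI: "x $ 0 = y $ 0 \<Longrightarrow> x $ 1 = y $ 1 \<Longrightarrow> x = (y :: qubit)"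
proof -
  assume "x $ 0 = y $ 0" "x $ 1 = y $ 1"
  then have "\<forall>i\<in>UNIV. x $ i = y $ i"
    by (simp add: UNIV_two)
  then show "x = y"
    by (simp add: vec_eq_iff)
qed

lemma herm_qubit: "herm x y = cnj (x $ 0) * y $ 0 + cnj (x $ 1) * (y :: qubit) $ 1"
  by (simp add: herm_def sum_two)

lemma herm_commute: "herm y x = cnj (herm x y)"
  by (simp add: herm_def mult.commute)

lemma herm_self: "herm x x = of_real ((norm x)\<^sup>2)"
  by (simp add: herm_def norm_vec_def L2_set_def complex_norm_square sum_nonneg mult.commute
      del: of_real_power)

lemma lagrange:
  assumes "norm x = 1" "norm y = 1"
  shows "(norm (wedge x y))\<^sup>2 + (norm (herm x y))\<^sup>2 = 1"
proof -
  have "complex_of_real ((norm (wedge x y))\<^sup>2 + (norm (herm x y))\<^sup>2) = herm x x * herm y y"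
    unfolding of_real_add complex_norm_square herm_qubit wedge_def by (simp add: algebra_simps)
  also have "\<dots> = 1"
    using assms by (simp add: herm_self)
  finally show ?thesis
    by (metis of_real_eq_1_iff)
qed

lemma wedge_commute: "wedge y x = - wedge x y"
  by (simp add: wedge_def)

lemma wedge_eq_0_sym: "wedge x y = 0 \<longleftrightarrow> wedge y x = 0"
  by (simp add: wedge_commute[of x y])

lemma wedge_trans:
  assumes "wedge x y = 0" "wedge y z = 0" "y \<noteq> 0"
  shows "wedge x z = 0"
proof -
  \<comment> \<open>For either coordinate k, y_k wedge(x,z) = z_k wedge(x,y) + x_k
    wedge(y,z).\<close>
  have "y $ 0 * wedge x z = 0" "y $ 1 * wedge x z = 0"
    using assms(1,2) unfolding wedge_def by algebra+
  with assms(3) show ?thesis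
    by (auto intro: qubit_eqI)
qed

text \<open>If the determinant vanishes, then \<open>x\<close> equals its projection onto
  \<open>y\<close>, and Lagrange's identity gives the coefficient \<open>herm y x\<close> modulus
  1.\<close>

lemma wedge_ne_0:
  assumes "norm x = 1" "norm y = 1" "x \<nsimeq> y"
  shows "wedge x y \<noteq> 0"
proof
  assume w: "wedge x y = 0"
  have "norm (herm y x) = 1"
    using lagrange[OF assms(1,2)] w by (simp add: herm_commute[of x y] abs_square_eq_1)
  moreover have "x = herm y x *s y"
  proof (rule qubit_eqI)
    have yy: "cnj (y $ 0) * y $ 0 + cnj (y $ 1) * y $ 1 = 1"
      using herm_self[of y] assms by (simp add: herm_qubit)
    have "x $ 0 - herm y x * y $ 0 = x $ 0 * (1 - (cnj (y $ 0) * y $ 0 + cnj (y $ 1) * y $ 1)) + cnj (y $ 1) * wedge x y"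
      by (simp add: herm_qubit wedge_def algebra_simps)
    then show "x $ 0 = (herm y x *s y) $ 0"
      using w yy by simp
    have "x $ 1 - herm y x * y $ 1 = x $ 1 * (1 - (cnj (y $ 0) * y $ 0 + cnj (y $ 1) * y $ 1)) - cnj (y $ 0) * wedge x y"
      by (simp add: herm_qubit wedge_def algebra_simps)
    then show "x $ 1 = (herm y x *s y) $ 1"
      using w yy by simp
  qed
  ultimately show False
    using assms(3) by (auto simp: same_state_def)
qed

lemma orth_mate_sym: "orth_mate x x' \<Longrightarrow> orth_mate x' x"
  by (simp add: orth_mate_def herm_commute[of x' x])

lemma orth_mate_wedge:
  assumes "orth_mate x x'"
  shows "norm (wedge x x') = 1"
  using assms lagrange[of x x'] by (simp add: orth_mate_def abs_square_eq_1)

lemma orth_mate_perp: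
  assumes "orth_mate x x'"
  obtains c where "norm c = 1" "x' $ 0 = - c * cnj (x $ 1)" "x' $ 1 = c * cnj (x $ 0)"
proof
  have xx: "cnj (x $ 0) * x $ 0 + cnj (x $ 1) * x $ 1 = 1"
    using herm_self[of x] assms by (simp add: herm_qubit orth_mate_def)
  have h: "cnj (x $ 0) * x' $ 0 + cnj (x $ 1) * x' $ 1 = 0"
    using assms by (simp add: herm_qubit orth_mate_def)
  \<comment> \<open>The phase sought is \<open>wedge x x'\<close> itself.\<close>
  show "norm (wedge x x') = 1"
    using assms by (rule orth_mate_wedge)
  show "x' $ 0 = - wedge x x' * cnj (x $ 1)"
    using xx h unfolding wedge_def by algebra
  show "x' $ 1 = wedge x x' * cnj (x $ 0)"
    using xx h unfolding wedge_def by algebra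
qed

text \<open>Up to phase, taking mates is a quarter turn followed by conjugation, so it only
  conjugates the determinant and multiplies it by a phase. Inequalities of states thus pass to their
  mates.\<close>

lemma norm_wedge_mates:
  assumes "orth_mate x x'" "orth_mate y y'"
  shows "norm (wedge x' y') = norm (wedge x y)"
proof -
  obtain c where c: "norm c = 1" "x' $ 0 = - c * cnj (x $ 1)" "x' $ 1 = c * cnj (x $ 0)"
    using orth_mate_perp[OF assms(1)] .
  obtain e where e: "norm e = 1" "y' $ 0 = - e * cnj (y $ 1)" "y' $ 1 = e * cnj (y $ 0)"
    using orth_mate_perp[OF assms(2)] .
  have "wedge x' y' = c * e * cnj (wedge x y)"
    using c e by (simp add: wedge_def algebra_simps)
  with c(1) e(1) show ?thesis
    by (simp add: norm_mult)
qed

lemma wedge_mates_eq_0: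
  assumes "orth_mate x x'" "orth_mate y y'"
  shows "wedge x' y' = 0 \<longleftrightarrow> wedge x y = 0"
  using norm_wedge_mates[OF assms] by (metis norm_eq_zero)

lemma orth_mate_ket: "orth_mate ket0 ket1"
  by (simp add: orth_mate_def ket0_def ket1_def herm_qubit axis_def norm_vec_def L2_set_def sum_two)

section \<open>Tensor products\<close>

lemma herm_tensor: "herm (tensor u v) (tensor u' v') = herm u u' * herm v v'"
  unfolding herm_def tensor_def sum_product sum.cartesian_product UNIV_Times_UNIV[symmetric]
  by (simp add: case_prod_beta mult_ac)

lemma norm_tensor: "norm (tensor u v) = norm u * norm v"
proof -
  have "complex_of_real ((norm (tensor u v))\<^sup>2) = of_real ((norm u * norm v)\<^sup>2)"
    by (simp only: herm_self[symmetric] herm_tensor power_mult_distrib of_real_mult)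
  then show ?thesis
    by (metis of_real_eq_iff power2_eq_iff_nonneg norm_ge_zero zero_le_mult_iff)
qed

definition flip :: "complex ^ ('m::finite \<times> 'n::finite) \<Rightarrow> complex ^ ('n \<times> 'm)" where
  "flip u = (\<chi> p. u $ (snd p, fst p))"

lemma flip_eq_0: "flip u = 0 \<longleftrightarrow> u = 0"
  by (auto simp: flip_def vec_eq_iff)

lemma herm_tensor_flip: "herm (tensor a b) (flip u) = herm (tensor b a) u"
  unfolding herm_def flip_def tensor_def
  by (rule sum.reindex_bij_witness[of _ prod.swap prod.swap]) (auto simp: mult_ac)

lemma herm_tensor_qubits:
  "herm (tensor a b) u = cnj (a $ 0) * cnj (b $ 0) * u $ (0, 0) + cnj (a $ 0) * cnj (b $ 1) * u $ (0, 1)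
     + cnj (a $ 1) * cnj (b $ 0) * u $ (1, 0) + cnj (a $ 1) * cnj (b $ 1) * (u :: complex ^ (2 \<times> 2)) $ (1, 1)"
  by (simp add: herm_def tensor_def UNIV_Times_UNIV[symmetric] UNIV_two del: UNIV_Times_UNIV)

text \<open>The 4x4 determinant with these rows, in its Laplace expansion along the first two. Being
  an explicit polynomial, it is accessible to \<open>algebra\<close>.\<close>

definition det4 ::
  "(nat \<Rightarrow> complex) \<Rightarrow> (nat \<Rightarrow> complex) \<Rightarrow> (nat \<Rightarrow> complex) \<Rightarrow> (nat \<Rightarrow> complex) \<Rightarrow> complex" where
  "det4 p q r s =
    (p 0 * q 1 - p 1 * q 0) * (r 2 * s 3 - r 3 * s 2) - (p 0 * q 2 - p 2 * q 0) * (r 1 * s 3 - r 3 * s 1)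
    + (p 0 * q 3 - p 3 * q 0) * (r 1 * s 2 - r 2 * s 1) + (p 1 * q 2 - p 2 * q 1) * (r 0 * s 3 - r 3 * s 0)
    - (p 1 * q 3 - p 3 * q 1) * (r 0 * s 2 - r 2 * s 0) + (p 2 * q 3 - p 3 * q 2) * (r 0 * s 1 - r 1 * s 0)"

text \<open>Cramer's rule: each coordinate of \<open>u\<close> times the determinant is a
  combination of the four equations, with cofactors as coefficients.\<close>

lemma det4_eq_0:
  fixes u :: "nat \<Rightarrow> complex"
  assumes "\<And>r. r \<in> {r1, r2, r3, r4} \<Longrightarrow> r 0 * u 0 + r 1 * u 1 + r 2 * u 2 + r 3 * u 3 = 0"
    and "u 0 \<noteq> 0 \<or> u 1 \<noteq> 0 \<or> u 2 \<noteq> 0 \<or> u 3 \<noteq> 0"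
  shows "det4 r1 r2 r3 r4 = 0"
proof -
  have e: "r1 0 * u 0 + r1 1 * u 1 + r1 2 * u 2 + r1 3 * u 3 = 0"
    "r2 0 * u 0 + r2 1 * u 1 + r2 2 * u 2 + r2 3 * u 3 = 0"
    "r3 0 * u 0 + r3 1 * u 1 + r3 2 * u 2 + r3 3 * u 3 = 0"
    "r4 0 * u 0 + r4 1 * u 1 + r4 2 * u 2 + r4 3 * u 3 = 0"
    using assms(1) by simp_all
  have "u 0 * det4 r1 r2 r3 r4 = 0" "u 1 * det4 r1 r2 r3 r4 = 0"
    "u 2 * det4 r1 r2 r3 r4 = 0" "u 3 * det4 r1 r2 r3 r4 = 0"
    using e unfolding det4_def by algebra+
  with assms(2) show ?thesis
    by auto
qed

lemma wedge_products:
  fixes u :: "complex ^ (2 \<times> 2)"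
  assumes "u \<noteq> 0"
    and "herm (tensor a1 b1) u = 0" "herm (tensor a2 b2) u = 0"
      "herm (tensor a3 b3) u = 0" "herm (tensor a4 b4) u = 0"
  shows "wedge a1 a2 * wedge a3 a4 * wedge b1 b3 * wedge b2 b4 =
    wedge a1 a3 * wedge a2 a4 * wedge b1 b2 * wedge b3 b4"
proof -
  define ix :: "nat \<Rightarrow> 2 \<times> 2" where "ix k = [(0, 0), (0, 1), (1, 0), (1, 1)] ! k" for k
  define r where "r a b k = cnj (a $ fst (ix k)) * cnj (b $ snd (ix k))" for a b :: qubit and k
  have ix: "ix 0 = (0, 0)" "ix 1 = (0, 1)" "ix 2 = (1, 0)" "ix 3 = (1, 1)"
    by (simp_all add: ix_def numeral_3_eq_3)
  have u: "u $ ix 0 \<noteq> 0 \<or> u $ ix 1 \<noteq> 0 \<or> u $ ix 2 \<noteq> 0 \<or> u $ ix 3 \<noteq> 0"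
  proof (rule ccontr)
    assume "\<not> ?thesis"
    then have "u $ (0, 0) = 0" "u $ (0, 1) = 0" "u $ (1, 0) = 0" "u $ (1, 1) = 0"
      by (simp_all only: ix de_Morgan_disj not_not)
    moreover have "p \<in> {(0, 0), (0, 1), (1, 0), (1, 1)}" for p :: "2 \<times> 2"
      using UNIV_two by (cases p) auto
    ultimately have "u $ p = 0" for p
      by (metis (no_types) insert_iff singletonD)
    then show False
      using \<open>u \<noteq> 0\<close> by (auto simp: vec_eq_iff)
  qed
  have "det4 (r a1 b1) (r a2 b2) (r a3 b3) (r a4 b4) = 0"
  proof (rule det4_eq_0[where u = "\<lambda>k. u $ ix k", OF _ u])
    fix s assume "s \<in> {r a1 b1, r a2 b2, r a3 b3, r a4 b4}"
    with assms(2-5) show "s 0 * u $ ix 0 + s 1 * u $ ix 1 + s 2 * u $ ix 2 + s 3 * u $ ix 3 = 0"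
      by (auto simp: r_def ix herm_tensor_qubits simp del: One_nat_def)
  qed
  \<comment> \<open>The conjugation is there because \<open>herm\<close> is conjugate linear in its
    first argument.\<close>
  moreover have "det4 (r a1 b1) (r a2 b2) (r a3 b3) (r a4 b4) =
      cnj (wedge a1 a3 * wedge a2 a4 * wedge b1 b2 * wedge b3 b4
        - wedge a1 a2 * wedge a3 a4 * wedge b1 b3 * wedge b2 b4)"
    unfolding det4_def r_def ix wedge_def by (simp add: ix algebra_simps del: One_nat_def)
  ultimately show ?thesis
    by (simp only: complex_cnj_zero_iff right_minus_eq)
qed

text \<open>The common factor puts \<open>wedge a a = 0\<close> into the left product of
  \<open>wedge_products\<close>; in the right product only the last factor can then vanish.\<close>

lemma wedge_products_share_left:
  fixes u :: "complex ^ (2 \<times> 2)"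
  assumes "u \<noteq> 0" "herm (tensor a b1) u = 0" "herm (tensor a b2) u = 0"
    "herm (tensor a3 b3) u = 0" "herm (tensor a4 b4) u = 0"
    and "wedge b1 b2 \<noteq> 0" "wedge a a3 \<noteq> 0" "wedge a a4 \<noteq> 0"
  shows "wedge b3 b4 = 0"
  using wedge_products[OF assms(1-5)] assms(6-) by (simp add: wedge_def[of a a])

lemma wedge_products_share_right:
  fixes u :: "complex ^ (2 \<times> 2)"
  assumes "u \<noteq> 0" "herm (tensor a1 b) u = 0" "herm (tensor a2 b) u = 0"
    "herm (tensor a3 b3) u = 0" "herm (tensor a4 b4) u = 0"
    and "wedge a1 a2 \<noteq> 0" "wedge b b3 \<noteq> 0" "wedge b b4 \<noteq> 0"
  shows "wedge a3 a4 = 0"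
  using wedge_products[OF assms(1-5)] assms(6-) by (simp add: wedge_def[of b b])

text \<open>For mates the identity of \<open>wedge_products\<close> has modulus 1 on the left, while by Lagrange's
  identity its right-hand side is at most \<open>(norm (wedge p q))\<^sup>2 < 1\<close>.\<close>

lemma no_orthogonal_to_mates:
  fixes u :: "complex ^ (2 \<times> 2)"
  assumes "orth_mate p p'" "orth_mate q q'" "orth_mate r r'" "orth_mate s s'" "wedge p' q \<noteq> 0"
    and "herm (tensor p r) u = 0" "herm (tensor p' s) u = 0"
      "herm (tensor q r') u = 0" "herm (tensor q' s') u = 0"
  shows "u = 0"
proof (rule ccontr)
  assume "u \<noteq> 0"
  have unit: "norm p = 1" "norm q = 1" "norm r = 1" "norm s = 1"
    using assms(1-4) by (simp_all add: orth_mate_def)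
  obtain e where "p' $ 0 = - e * cnj (p $ 1)" "p' $ 1 = e * cnj (p $ 0)"
    using orth_mate_perp[OF assms(1)] .
  \<comment> \<open>So the hypothesis on \<open>p'\<close> and \<open>q\<close> says that
    \<open>p\<close> and \<open>q\<close> are not orthogonal, which makes the bound on
    \<open>wedge p q\<close> strict.\<close>
  then have "wedge p' q = - e * herm p q"
    by (simp add: wedge_def herm_qubit algebra_simps)
  with assms(5) have "herm p q \<noteq> 0"
    by auto
  then have pq: "(norm (wedge p q))\<^sup>2 < 1"
    using lagrange[OF unit(1,2)] by (smt (verit) zero_less_norm_iff zero_less_power)
  have rs: "(norm (wedge r s))\<^sup>2 \<le> 1"
    using lagrange[OF unit(3,4)] by (smt (verit) zero_le_power2)
  have "norm (wedge p p' * wedge q q' * wedge r r' * wedge s s') =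
      norm (wedge p q * wedge p' q' * wedge r s * wedge r' s')"
    using wedge_products[OF \<open>u \<noteq> 0\<close> assms(6-9)] by simp
  then have "1 = (norm (wedge p q))\<^sup>2 * (norm (wedge r s))\<^sup>2"
    using assms(1-4) by (simp add: norm_mult orth_mate_wedge norm_wedge_mates power2_eq_square)
  also have "\<dots> \<le> (norm (wedge p q))\<^sup>2"
    using rs by (simp add: mult_left_le)
  finally show False
    using pq by simp
qed

section \<open>The cube of rows\<close>

definition two_bases :: "(bool \<Rightarrow> bool \<Rightarrow> qubit) \<Rightarrow> bool" where
  "two_bases a \<longleftrightarrow> (\<forall>x y. orth_mate (a x y) (a x (\<not> y))) \<and> (\<forall>y z. wedge (a False y) (a True z) \<noteq> 0)"

lemma two_bases_mate: "two_bases a \<Longrightarrow> orth_mate (a x y) (a x (\<not> y))"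
  by (simp add: two_bases_def)

lemma two_bases_norm: "two_bases a \<Longrightarrow> norm (a x y) = 1"
  by (meson two_bases_mate orth_mate_def)

lemma two_bases_wedge:
  assumes "two_bases a" "(x, y) \<noteq> (x', y')"
  shows "wedge (a x y) (a x' y') \<noteq> 0"
proof (cases "x = x'")
  case True
  with assms(2) have "y' = (\<not> y)"
    by auto
  with True show ?thesis
    using orth_mate_wedge[OF two_bases_mate[OF assms(1)], of x y] by auto
next
  case False
  then show ?thesis
    using assms(1) wedge_commute[of "a x y" "a x' y'"]
    by (cases x; cases x') (auto simp: two_bases_def)
qed

lemma two_basesI:
  assumes "orth_mate f f'" "f \<nsimeq> ket0" "f \<nsimeq> ket1"
  shows "two_bases (\<lambda>x y. if x then if y then f' else f else if y then ket1 else ket0)"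
proof -
  have unit: "norm f = 1" "norm ket0 = 1" "norm ket1 = 1"
    using assms(1) orth_mate_ket by (simp_all add: orth_mate_def)
  then have "wedge f ket0 \<noteq> 0" "wedge f ket1 \<noteq> 0"
    using assms(2,3) by (simp_all add: wedge_ne_0)
  \<comment> \<open>Taking mates exchanges \<open>ket0\<close> and \<open>ket1\<close>, so the
    conditions on \<open>f\<close> give those on \<open>f'\<close>.\<close>
  moreover have "wedge f' ket0 \<noteq> 0" "wedge f' ket1 \<noteq> 0"
    using calculation wedge_mates_eq_0[OF assms(1) orth_mate_ket]
      wedge_mates_eq_0[OF assms(1) orth_mate_sym[OF orth_mate_ket]] by simp_all
  ultimately show ?thesis
    using assms(1) orth_mate_ket orth_mate_sym[OF assms(1)] orth_mate_sym[OF orth_mate_ket]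
    by (simp add: two_bases_def wedge_commute[of f] wedge_commute[of f'])
qed

text \<open>\<open>W\<close> stands for equality of the states of \<open>d\<close> at two vertices.
  Over \<open>bool\<close> the claim is propositional, and \<open>sat\<close> decides it. By hand: a
  \<open>P\<close> with an x- or z-edge has at most 4 vertices, and so has one without; likewise
  \<open>Q\<close> with or without a y-edge. Hence they are complementary 4-sets. If
  \<open>P\<close> has no x- or z-edge, it is z = x + y + k, which is excluded, or z = x + k, which
  leaves two y-edges to \<open>Q\<close>. Otherwise \<open>P\<close> is a z-edge and an x-edge in
  opposite y-layers; then \<open>Q\<close> has a y-edge whose two companions are antipodal.\<close>

lemma no_cube_cover:
  fixes P Q :: "bool \<Rightarrow> bool \<Rightarrow> bool \<Rightarrow> bool"
    and W :: "bool \<Rightarrow> bool \<Rightarrow> bool \<Rightarrow> bool \<Rightarrow> bool \<Rightarrow> bool \<Rightarrow> bool"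
  assumes "\<And>x y z. P x y z \<or> Q x y z"
    and "\<And>x y x1 y1 z1 x2 y2 z2. \<lbrakk>P x y False; P x y True; P x1 y1 z1; P x2 y2 z2;
      (x1, y1) \<noteq> (x, y); (x2, y2) \<noteq> (x, y)\<rbrakk> \<Longrightarrow> y1 = y2 \<and> z1 = z2"
    and "\<And>y z x1 y1 z1 x2 y2 z2. \<lbrakk>P False y z; P True y z; P x1 y1 z1; P x2 y2 z2;
      (y1, z1) \<noteq> (y, z); (y2, z2) \<noteq> (y, z)\<rbrakk> \<Longrightarrow> x1 = x2 \<and> y1 = y2"
    and "\<And>k. \<not> (\<forall>x y. P x y ((x \<noteq> y) = k))"
    and "\<And>x z x1 y1 z1 x2 y2 z2. \<lbrakk>Q x False z; Q x True z; Q x1 y1 z1; Q x2 y2 z2;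
      (x1, z1) \<noteq> (x, z); (x2, z2) \<noteq> (x, z)\<rbrakk> \<Longrightarrow> W x1 y1 z1 x2 y2 z2"
    and "\<And>y z. \<not> W False y z True y z" "\<And>x z. \<not> W x False z x True z"
      "\<And>x y. \<not> W x y False x y True"
    and "\<And>x y z. \<not> W x y z (\<not> x) (\<not> y) (\<not> z)"
    and "\<And>x y z. W (\<not> x) y z x (\<not> y) z \<Longrightarrow> \<not> W x (\<not> y) z x y (\<not> z)"
  shows False
  by (insert assms, atomize (full), simp only: all_bool_eq prod.inject simp_thms) sat

text \<open>In \<open>d_neighbours\<close>, two consecutive comparisons suffice to say that the
  three neighbours of a vertex do not all carry one state, since \<open>wedge_trans\<close> supplies
  the third.\<close>

locale cube =
  fixes a b c :: "bool \<Rightarrow> bool \<Rightarrow> qubit" and d :: "bool \<Rightarrow> bool \<Rightarrow> bool \<Rightarrow> qubit"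
  assumes bases: "two_bases a" "two_bases b" "two_bases c"
    and d_mate: "orth_mate (d x y z) (d (\<not> x) (\<not> y) (\<not> z))"
    and d_adjacent: "wedge (d False y z) (d True y z) \<noteq> 0" "wedge (d x False z) (d x True z) \<noteq> 0"
      "wedge (d x y False) (d x y True) \<noteq> 0"
    and d_neighbours: "wedge (d (\<not> x) y z) (d x (\<not> y) z) = 0 \<Longrightarrow>
      wedge (d x (\<not> y) z) (d x y (\<not> z)) \<noteq> 0"
begin

lemma d_norm: "norm (d x y z) = 1"
  using d_mate[of x y z] by (simp add: orth_mate_def)

text \<open>The vertex (x,y,z) of the new cube is (z,x,y) of the old one.
  \<open>d_neighbours\<close> then compares other pairs of the same three neighbours, which
  transitivity repairs.\<close>

lemma rotate: "cube b c a (\<lambda>x y z. d z x y)"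
proof
  fix x y z
  assume yz: "wedge (d z (\<not> x) y) (d z x (\<not> y)) = 0"
  show "wedge (d z x (\<not> y)) (d (\<not> z) x y) \<noteq> 0"
  proof
    assume "wedge (d z x (\<not> y)) (d (\<not> z) x y) = 0"
    moreover have "d z x (\<not> y) \<noteq> 0"
      using d_norm[of z x "\<not> y"] by auto
    ultimately have "wedge (d z (\<not> x) y) (d (\<not> z) x y) = 0"
      using yz wedge_trans by blast
    then show False
      using d_neighbours[of z x y] yz wedge_commute[of "d z (\<not> x) y"] by simp
  qed
qed (use bases d_mate d_adjacent in auto)

lemma not_orthogonal:
  fixes u v :: "complex ^ (2 \<times> 2)"
  assumes "u \<noteq> 0" "v \<noteq> 0"
  shows "\<exists>x y z. herm (tensor (a x y) (b y z)) u \<noteq> 0 \<and> herm (tensor (c z x) (d x y z)) v \<noteq> 0"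
proof (rule ccontr)
  assume not: "\<not> ?thesis"
  define P where "P x y z \<longleftrightarrow> herm (tensor (a x y) (b y z)) u = 0" for x y z
  define Q where "Q x y z \<longleftrightarrow> herm (tensor (c z x) (d x y z)) v = 0" for x y z
  \<comment> \<open>The ends of a z-edge share their A factor. The other two vertices have different
    A factors from it, so their B factors must coincide, and these determine y and z.\<close>
  have Pa: "y1 = y2 \<and> z1 = z2"
    if "P x y False" "P x y True" "P x1 y1 z1" "P x2 y2 z2" "(x1, y1) \<noteq> (x, y)" "(x2, y2) \<noteq> (x, y)"
    for x y x1 y1 z1 x2 y2 z2
  proof -
    have "wedge (b y1 z1) (b y2 z2) = 0"
      by (rule wedge_products_share_left[OF \<open>u \<noteq> 0\<close> that(1-4)[unfolded P_def]
            two_bases_wedge[OF bases(2)] two_bases_wedge[OF bases(1)] two_bases_wedge[OF bases(1)]])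
        (use that(5,6) in auto)
    then show ?thesis
      using two_bases_wedge[OF bases(2), of y1 z1 y2 z2] by auto
  qed
  have Pb: "x1 = x2 \<and> y1 = y2"
    if "P False y z" "P True y z" "P x1 y1 z1" "P x2 y2 z2" "(y1, z1) \<noteq> (y, z)" "(y2, z2) \<noteq> (y, z)"
    for y z x1 y1 z1 x2 y2 z2
  proof -
    have "wedge (a x1 y1) (a x2 y2) = 0"
      by (rule wedge_products_share_right[OF \<open>u \<noteq> 0\<close> that(1-4)[unfolded P_def]
            two_bases_wedge[OF bases(1)] two_bases_wedge[OF bases(2)] two_bases_wedge[OF bases(2)]])
        (use that(5,6) in auto)
    then show ?thesis
      using two_bases_wedge[OF bases(1), of x1 y1 x2 y2] by auto
  qed
  have Pd: "\<not> (\<forall>x y. P x y ((x \<noteq> y) = k))" for k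
  proof
    assume P: "\<forall>x y. P x y ((x \<noteq> y) = k)"
    have "u = 0"
    \<comment> \<open>At these four vertices each of the four A states and each of the four B states
      occurs once; mates on the A side lie over different bases on the B side.\<close>
    proof (rule no_orthogonal_to_mates)
      show "orth_mate (a False False) (a False True)" "orth_mate (a True False) (a True True)"
        "orth_mate (b False (\<not> k)) (b False k)" "orth_mate (b True k) (b True (\<not> k))"
        using two_bases_mate[OF bases(1), of _ False] two_bases_mate[OF bases(2), of _ "\<not> k"]
          two_bases_mate[OF bases(2), of _ k] by simp_all
      show "wedge (a False True) (a True False) \<noteq> 0"
        by (intro two_bases_wedge bases) simp
    qed (use P in \<open>auto simp: P_def all_bool_eq\<close>)
    with \<open>u \<noteq> 0\<close> show False
      by simp
  qed
  \<comment> \<open>The ends of a y-edge share their C factor. Here only equality of states follows,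
    since \<open>d\<close> may repeat a state.\<close>
  have Qc: "wedge (d x1 y1 z1) (d x2 y2 z2) = 0"
    if "Q x False z" "Q x True z" "Q x1 y1 z1" "Q x2 y2 z2" "(x1, z1) \<noteq> (x, z)" "(x2, z2) \<noteq> (x, z)"
    for x z x1 y1 z1 x2 y2 z2
    by (rule wedge_products_share_left[OF \<open>v \<noteq> 0\<close> that(1-4)[unfolded Q_def]
          d_adjacent(2) two_bases_wedge[OF bases(3)] two_bases_wedge[OF bases(3)]])
      (use that(5,6) in auto)
  have antipodal: "wedge (d x y z) (d (\<not> x) (\<not> y) (\<not> z)) \<noteq> 0" for x y z
    using orth_mate_wedge[OF d_mate[of x y z]] by auto
  have PQ: "P x y z \<or> Q x y z" for x y z
    using not by (auto simp: P_def Q_def)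
  show False
    by (rule no_cube_cover[of P Q "\<lambda>x y z x' y' z'. wedge (d x y z) (d x' y' z') = 0",
          OF PQ Pa Pb Pd Qc d_adjacent antipodal d_neighbours])
qed

text \<open>Distinct vertices are antipodal, or in cyclic order some coordinate that agrees is
  followed by one that differs. In the latter case the column indexed by these two holds
  mates.\<close>

lemma rows_orthogonal:
  assumes "(x, y, z) \<noteq> (x', y', z')"
  shows "herm (a x y) (a x' y') = 0 \<or> herm (b y z) (b y' z') = 0 \<or>
    herm (c z x) (c z' x') = 0 \<or> herm (d x y z) (d x' y' z') = 0"
proof -
  have mate: "herm (s p q) (s p q') = 0" if "two_bases s" "q \<noteq> q'" for s p q q'
  proof -
    from that have "q' = (\<not> q)"
      by auto
    then show ?thesis
      using two_bases_mate[OF that(1)] by (simp add: orth_mate_def)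
  qed
  consider "x = x'" "y \<noteq> y'" | "y = y'" "z \<noteq> z'" | "z = z'" "x \<noteq> x'" | "x \<noteq> x'" "y \<noteq> y'" "z \<noteq> z'"
    using assms by auto
  then show ?thesis
  proof cases
    case 4
    then have "x' = (\<not> x)" "y' = (\<not> y)" "z' = (\<not> z)"
      by auto
    then show ?thesis
      using d_mate[of x y z] by (simp add: orth_mate_def)
  qed (simp_all add: mate[OF bases(1)] mate[OF bases(2)] mate[OF bases(3)])
qed

end

section \<open>Bipartite product bases\<close>

lemma bipartite_UPB_range:
  fixes f :: "'i \<Rightarrow> complex ^ 'm::finite" and g :: "'i \<Rightarrow> complex ^ 'n::finite"
  assumes "\<And>r. norm (f r) = 1" "\<And>r. norm (g r) = 1"
    and "\<And>r s. r \<noteq> s \<Longrightarrow> herm (f r) (f s) * herm (g r) (g s) = 0"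
    and "\<And>u v. u \<noteq> 0 \<Longrightarrow> v \<noteq> 0 \<Longrightarrow> \<exists>r. herm (f r) u \<noteq> 0 \<and> herm (g r) v \<noteq> 0"
  shows "bipartite_UPB (range (\<lambda>r. tensor (f r) (g r)))"
  unfolding bipartite_UPB_def
proof (intro conjI ballI impI)
  fix \<psi> assume "\<psi> \<in> range (\<lambda>r. tensor (f r) (g r))"
  then obtain r where r: "\<psi> = tensor (f r) (g r)"
    by auto
  show "product_vector \<psi>"
    unfolding product_vector_def r
    using assms(1,2)[of r] by (intro exI[of _ "f r"] exI[of _ "g r"]) auto
  show "norm \<psi> = 1"
    by (simp add: r norm_tensor assms)
  fix \<phi> assume "\<phi> \<in> range (\<lambda>r. tensor (f r) (g r))" and ne: "\<psi> \<noteq> \<phi>"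
  then obtain s where s: "\<phi> = tensor (f s) (g s)"
    by auto
  with r ne have "r \<noteq> s"
    by auto
  then show "herm \<psi> \<phi> = 0"
    using assms(3) by (simp add: r s herm_tensor)
next
  show "\<not> (\<exists>\<phi>. product_vector \<phi> \<and> (\<forall>\<psi>\<in>range (\<lambda>r. tensor (f r) (g r)). herm \<psi> \<phi> = 0))"
  proof
    assume "\<exists>\<phi>. product_vector \<phi> \<and> (\<forall>\<psi>\<in>range (\<lambda>r. tensor (f r) (g r)). herm \<psi> \<phi> = 0)"
    then obtain u v where "u \<noteq> 0" "v \<noteq> 0"
      and "\<And>r. herm (tensor (f r) (g r)) (tensor u v) = 0"
      unfolding product_vector_def by auto
    then show False
      using assms(4)[of u v] by (auto simp: herm_tensor)
  qed
qed

lemma across_row_vector: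
  "across_AB_CD (row_vector (p, q, r, s)) = tensor (tensor p q) (tensor r s)"
  "across_AC_BD (row_vector (p, q, r, s)) = tensor (tensor p r) (tensor q s)"
  "across_AD_BC (row_vector (p, q, r, s)) = tensor (tensor p s) (tensor q r)"
  by (auto simp: across_AB_CD_def across_AC_BD_def across_AD_BC_def tensor_def vec_eq_iff mult_ac)

section \<open>The rows of a cube across the three partitions\<close>

context cube
begin

definition row :: "bool \<times> bool \<times> bool \<Rightarrow> qubit \<times> qubit \<times> qubit \<times> qubit" where
  "row = (\<lambda>(x, y, z). (a x y, b y z, c z x, d x y z))"

lemma row_orthogonal:
  assumes "r \<noteq> s"
  shows "herm (row_vector (row r)) (row_vector (row s)) = 0"
proof -
  obtain x y z x' y' z' where "r = (x, y, z)" "s = (x', y', z')"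
    by (metis prod_cases3)
  with rows_orthogonal[of x y z x' y' z'] assms show ?thesis
    by (auto simp: row_def herm_tensor)
qed

text \<open>Two equal rows at distinct vertices would be a unit vector orthogonal to itself.\<close>

lemma card_rows: "card (row_vector ` range row) = 8"
proof -
  have unit: "norm (row_vector (row r)) = 1" for r
    by (cases r) (simp add: row_def norm_tensor two_bases_norm bases d_norm)
  have "inj (\<lambda>r. row_vector (row r))"
  proof (rule injI, rule ccontr)
    fix r s assume "row_vector (row r) = row_vector (row s)" "r \<noteq> s"
    then show False
      using row_orthogonal[of r s] herm_self[of "row_vector (row s)"] unit[of s] by simp
  qed
  then have "card (range (\<lambda>r. row_vector (row r))) = CARD(bool \<times> bool \<times> bool)"
    by (rule card_image)
  then show ?thesis
    by (simp add: image_image)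
qed

lemma bipartite_UPB_AB_CD: "bipartite_UPB (across_AB_CD ` row_vector ` range row)"
proof -
  have "bipartite_UPB (range (\<lambda>r. tensor ((\<lambda>(x, y, z). tensor (a x y) (b y z)) r)
      ((\<lambda>(x, y, z). tensor (c z x) (d x y z)) r)))"
  proof (rule bipartite_UPB_range, goal_cases)
    case (3 r s)
    then show ?case
      using row_orthogonal[OF 3] by (auto simp: row_def herm_tensor case_prod_beta)
  next
    case (4 u v)
    then show ?case
      using not_orthogonal[of u v] by auto
  qed (auto simp: norm_tensor two_bases_norm bases d_norm)
  also have "(\<lambda>r. tensor ((\<lambda>(x, y, z). tensor (a x y) (b y z)) r)
      ((\<lambda>(x, y, z). tensor (c z x) (d x y z)) r)) = (\<lambda>r. across_AB_CD (row_vector (row r)))"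
    by (auto simp: row_def across_row_vector simp del: row_vector.simps)
  finally show ?thesis
    by (simp add: image_image)
qed

lemma bipartite_UPB_AC_BD: "bipartite_UPB (across_AC_BD ` row_vector ` range row)"
proof -
  \<comment> \<open>Two shifts turn AB:CD into CA:BD; \<open>flip\<close> later restores the order
    AC.\<close>
  interpret shifted: cube c a b "\<lambda>x y z. d y z x"
    using cube.rotate[OF rotate] .
  have "bipartite_UPB (range (\<lambda>r. tensor ((\<lambda>(x, y, z). tensor (a x y) (c z x)) r)
      ((\<lambda>(x, y, z). tensor (b y z) (d x y z)) r)))"
  proof (rule bipartite_UPB_range, goal_cases)
    case (3 r s)
    then show ?case
      using row_orthogonal[OF 3] by (auto simp: row_def herm_tensor case_prod_beta)
  next
    case (4 u v)
    then show ?case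
      using shifted.not_orthogonal[of "flip u" v] by (auto simp: herm_tensor_flip flip_eq_0)
  qed (auto simp: norm_tensor two_bases_norm bases d_norm)
  also have "(\<lambda>r. tensor ((\<lambda>(x, y, z). tensor (a x y) (c z x)) r)
      ((\<lambda>(x, y, z). tensor (b y z) (d x y z)) r)) = (\<lambda>r. across_AC_BD (row_vector (row r)))"
    by (auto simp: row_def across_row_vector simp del: row_vector.simps)
  finally show ?thesis
    by (simp add: image_image)
qed

lemma bipartite_UPB_AD_BC: "bipartite_UPB (across_AD_BC ` row_vector ` range row)"
proof -
  \<comment> \<open>One shift turns AB:CD into BC:AD, so the parties, and with them \<open>u\<close>
    and \<open>v\<close>, change places.\<close>
  interpret shifted: cube b c a "\<lambda>x y z. d z x y"
    by (rule rotate)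
  have "bipartite_UPB (range (\<lambda>r. tensor ((\<lambda>(x, y, z). tensor (a x y) (d x y z)) r)
      ((\<lambda>(x, y, z). tensor (b y z) (c z x)) r)))"
  proof (rule bipartite_UPB_range, goal_cases)
    case (3 r s)
    then show ?case
      using row_orthogonal[OF 3] by (auto simp: row_def herm_tensor case_prod_beta)
  next
    case (4 u v)
    then show ?case
      using shifted.not_orthogonal[of v u] by auto
  qed (auto simp: norm_tensor two_bases_norm bases d_norm)
  also have "(\<lambda>r. tensor ((\<lambda>(x, y, z). tensor (a x y) (d x y z)) r)
      ((\<lambda>(x, y, z). tensor (b y z) (c z x)) r)) = (\<lambda>r. across_AD_BC (row_vector (row r)))"
    by (auto simp: row_def across_row_vector simp del: row_vector.simps)
  finally show ?thesis
    by (simp add: image_image)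
qed

end

section \<open>The given matrix as a cube\<close>

theorem lemma6:
  fixes f5 f5' g3 g3' h2 h2' i2 i2' i3 i3' i4 i4' :: qubit
  assumes "orth_mate f5 f5'" "orth_mate g3 g3'" "orth_mate h2 h2'"
    and "orth_mate i2 i2'" "orth_mate i3 i3'" "orth_mate i4 i4'"
    and "f5 \<nsimeq> ket0" "f5 \<nsimeq> ket1"
    and "g3 \<nsimeq> ket0" "g3 \<nsimeq> ket1"
    and "h2 \<nsimeq> ket0" "h2 \<nsimeq> ket1"
    and "i2 \<nsimeq> ket0" "i2 \<nsimeq> i3'" "i2 \<nsimeq> i4"
    and "i3 \<nsimeq> ket0" "i3 \<nsimeq> i4"
    and "i4 \<nsimeq> ket0" "i4 \<nsimeq> ket1"
    and "i2 \<simeq> i3 \<longrightarrow> i2 \<nsimeq> ket1 \<and> i2 \<nsimeq> i4'"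
  shows "card (F6 f5 f5' g3 g3' h2 h2' i2 i2' i3 i3' i4 i4') = 8 \<and>
         bipartite_UPB (across_AB_CD ` F6 f5 f5' g3 g3' h2 h2' i2 i2' i3 i3' i4 i4') \<and>
         bipartite_UPB (across_AC_BD ` F6 f5 f5' g3 g3' h2 h2' i2 i2' i3 i3' i4 i4') \<and>
         bipartite_UPB (across_AD_BC ` F6 f5 f5' g3 g3' h2 h2' i2 i2' i3 i3' i4 i4')"
proof -
  define basis :: "qubit \<Rightarrow> qubit \<Rightarrow> bool \<Rightarrow> bool \<Rightarrow> qubit" where
    "basis = (\<lambda>f f' x y. if x then if y then f' else f else if y then ket1 else ket0)"
  \<comment> \<open>This is the fourth column, read in the vertex order 000, 001, 010, 011, 101,
    100, 110, 111.\<close>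
  define d where "d x y z =
    (if x then if y then if z then ket1 else i2' else if z then i3' else i4'
     else if y then if z then i4 else i3 else if z then i2 else ket0)" for x y z
  have unit: "norm i2 = 1" "norm i3 = 1" "norm i4 = 1" "norm i2' = 1" "norm i3' = 1" "norm i4' = 1"
      "norm ket0 = 1" "norm ket1 = 1"
    using assms(4-6) orth_mate_ket by (simp_all add: orth_mate_def)
  note mates = assms(4-6) assms(4-6)[THEN orth_mate_sym] orth_mate_ket orth_mate_ket[THEN orth_mate_sym]
  have ne: "wedge i2 ket0 \<noteq> 0" "wedge i2 i3' \<noteq> 0" "wedge i2 i4 \<noteq> 0" "wedge i3 ket0 \<noteq> 0"
      "wedge i3 i4 \<noteq> 0" "wedge i4 ket0 \<noteq> 0" "wedge i4 ket1 \<noteq> 0"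
    using assms unit by (simp_all add: wedge_ne_0)
  \<comment> \<open>Taking mates is the antipodal map on the values of \<open>d\<close>, so each
    inequality yields the antipodal one.\<close>
  have ne': "wedge i2' ket1 \<noteq> 0" "wedge i2' i3 \<noteq> 0" "wedge i2' i4' \<noteq> 0" "wedge i3' ket1 \<noteq> 0"
      "wedge i3' i4' \<noteq> 0" "wedge i4' ket1 \<noteq> 0" "wedge i4' ket0 \<noteq> 0"
    using ne wedge_mates_eq_0[OF assms(4) orth_mate_ket] wedge_mates_eq_0[OF assms(4) orth_mate_sym[OF assms(5)]]
      wedge_mates_eq_0[OF assms(4,6)] wedge_mates_eq_0[OF assms(5) orth_mate_ket] wedge_mates_eq_0[OF assms(5,6)]
      wedge_mates_eq_0[OF assms(6) orth_mate_ket] wedge_mates_eq_0[OF assms(6) orth_mate_sym[OF orth_mate_ket]]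
    by simp_all
  have ne_sym: "wedge q p \<noteq> 0" if "wedge p q \<noteq> 0" for p q
    using that wedge_commute[of p q] by simp
  note ne = ne ne' ne[THEN ne_sym] ne'[THEN ne_sym]
  \<comment> \<open>The neighbours of 011 carry \<open>i2\<close>, \<open>i3\<close>,
    \<open>ket1\<close>, and those of 000 carry \<open>i2\<close>, \<open>i3\<close>,
    \<open>i4'\<close>. The mates treat 100 and 111. At the other four vertices \<open>i4\<close>
    and \<open>ket0\<close>, or \<open>i4'\<close> and \<open>ket1\<close>, are among the
    neighbours.\<close>
  have triple: "wedge i2 ket1 \<noteq> 0 \<and> wedge i2 i4' \<noteq> 0" if "wedge i2 i3 = 0"
    using that assms(20) wedge_ne_0[of i2 i3] wedge_ne_0[of i2 ket1] wedge_ne_0[of i2 i4'] unit by auto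
  then have triple': "wedge i2' ket0 \<noteq> 0 \<and> wedge i2' i4 \<noteq> 0" if "wedge i2' i3' = 0"
    using that wedge_mates_eq_0[OF assms(4,5)] wedge_mates_eq_0[OF assms(4) orth_mate_sym[OF assms(6)]]
      wedge_mates_eq_0[OF assms(4) orth_mate_sym[OF orth_mate_ket]] by simp
  have trans: "wedge p q = 0 \<Longrightarrow> wedge q r = 0 \<Longrightarrow> q \<noteq> 0 \<Longrightarrow> wedge r p = 0" for p q r
    using wedge_trans wedge_eq_0_sym by blast
  interpret cube "basis f5 f5'" "basis g3 g3'" "basis h2 h2'" d
  proof
    show "two_bases (basis f5 f5')" "two_bases (basis g3 g3')" "two_bases (basis h2 h2')"
      unfolding basis_def using assms by (simp_all add: two_basesI)
    fix x y z
    show "orth_mate (d x y z) (d (\<not> x) (\<not> y) (\<not> z))"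
      using mates by (simp add: d_def)
    show "wedge (d False y z) (d True y z) \<noteq> 0"
      using ne by (simp add: d_def)
    show "wedge (d x False z) (d x True z) \<noteq> 0"
      using ne by (simp add: d_def)
    show "wedge (d x y False) (d x y True) \<noteq> 0"
      using ne by (simp add: d_def)
    assume *: "wedge (d (\<not> x) y z) (d x (\<not> y) z) = 0"
    show "wedge (d x (\<not> y) z) (d x y (\<not> z)) \<noteq> 0"
    proof
      assume **: "wedge (d x (\<not> y) z) (d x y (\<not> z)) = 0"
      have nz: "i3 \<noteq> 0" "i3' \<noteq> 0"
        using unit by auto
      \<comment> \<open>At 000 and 111 the two comparisons have \<open>i3\<close> or
        \<open>i3'\<close> in the middle, so transitivity must supply the remaining pair.\<close>
      show False
        using * ** ne triple triple' trans[of i4' i3 i2] trans[of i4 i3' i2'] nz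
          wedge_eq_0_sym[of i2 i3] wedge_eq_0_sym[of i2' i3'] wedge_eq_0_sym[of i2 ket1] wedge_eq_0_sym[of i2' ket0]
        by (cases x; cases y; cases z) (simp_all add: d_def)
    qed
  qed
  \<comment> \<open>Only the sets of rows have to agree, so \<open>insert_commute\<close> absorbs
    the order of enumeration.\<close>
  have "F6 f5 f5' g3 g3' h2 h2' i2 i2' i3 i3' i4 i4' = row_vector ` range row"
    unfolding F6_def
    by (rule arg_cong[of _ _ "image row_vector"], unfold row_def)
      (simp add: basis_def d_def UNIV_Times_UNIV[symmetric] UNIV_bool
        insert_commute del: UNIV_Times_UNIV)
  then show ?thesis
    using card_rows bipartite_UPB_AB_CD bipartite_UPB_AC_BD bipartite_UPB_AD_BC by simp
qed

end
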